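(* There exist a probability space $(\Omega,\mathcal F,P)$ and a real-valued stochastic process $(B_t)_{t\in\mathbb R_+}$ on it such that: (i) $B$ has continuous paths, i.e. for every $\omega\in\Omega$ the map $t\mapsto B_t(\omega)$ is continuous on $\mathbb R_+$; (ii) $B_0=0$ almost surely; (iii) for all $n\in\mathbb N$ and all $t_1,\dots,t_n\in\mathbb R_+$, the vector $(B_{t_1},\dots,B_{t_n})$ has a multivariate normal distribution with mean $0$ and covariance matrix given by $\mathbf{cov}(B_{t_i},B_{t_j})=t_i\wedge t_j$.
   Context: $\mathbb R_+=[0,\infty)$ and $s\wedge t=\min(s,t)$. Multivariate normal distributions are allowed to be degenerate (the covariance matrix is only required to be positive semidefinite). *)

theory Defs
  imports "HOL-Probability.Probability"
begin

text \<open>A point mass counts as a normal distribution (of variance zero). It is a separate disjunct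
  because \<^term>\<open>normal_density m 0\<close> is identically zero and hence not a probability density.\<close>

definition normally_distributed :: "'a measure \<Rightarrow> ('a \<Rightarrow> real) \<Rightarrow> bool" where
  "normally_distributed M X \<longleftrightarrow> X \<in> borel_measurable M \<and>
     ((\<exists>m. AE \<omega> in M. X \<omega> = m) \<or>
      (\<exists>m \<sigma>. \<sigma> > 0 \<and> distributed M lborel X (normal_density m \<sigma>)))"

definition covariance :: "'a measure \<Rightarrow> ('a \<Rightarrow> real) \<Rightarrow> ('a \<Rightarrow> real) \<Rightarrow> real" where
  "covariance M X Y =
     (\<integral>\<omega>. (X \<omega> - (\<integral>\<eta>. X \<eta> \<partial>M)) * (Y \<omega> - (\<integral>\<eta>. Y \<eta> \<partial>M)) \<partial>M)"

text \<open>A random vector \<open>(X i)\<close>, \<open>i \<in> I\<close>, with \<open>I\<close> finite, is multivariate normal if all linear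
  combinations of its components are normal; the covariance matrix may be singular. The components
  are then square integrable, so the integrals giving the means and covariances do exist.\<close>

definition multivariate_normal ::
  "'a measure \<Rightarrow> 'i set \<Rightarrow> ('i \<Rightarrow> 'a \<Rightarrow> real) \<Rightarrow> ('i \<Rightarrow> real) \<Rightarrow> ('i \<Rightarrow> 'i \<Rightarrow> real) \<Rightarrow> bool" where
  "multivariate_normal M I X \<mu> \<Sigma> \<longleftrightarrow>
     prob_space M \<and> finite I \<and>
     (\<forall>i\<in>I. X i \<in> borel_measurable M) \<and>
     (\<forall>c :: 'i \<Rightarrow> real. normally_distributed M (\<lambda>\<omega>. \<Sum>i\<in>I. c i * X i \<omega>)) \<and>
     (\<forall>i\<in>I. (\<integral>\<omega>. X i \<omega> \<partial>M) = \<mu> i) \<and>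
     (\<forall>i\<in>I. \<forall>j\<in>I. covariance M (X i) (X j) = \<Sigma> i j)"

end

(* Levy's construction: Brownian motion is the random series with independent standard normal
   coefficients in the Schauder functions (integrated Haar functions) of all dyadic levels.
   The partial sums of the covariance kernel telescope to 2^-n times the sum over k of
   ramp (2^n s - k) * ramp (2^n t - k), which is within 2^-n of min s t. On compact sets the n-th
   layer is at most 2^(-n/2) times the largest of O(2^n) coefficients, so that a moment bound and
   Borel-Cantelli give almost sure uniform convergence, hence continuity. Off the almost sure event the process is
   set to 0. The finite-dimensional laws are limits of Gaussian ones, identified by their
   characteristic functions; covariances follow by polarization. *)

theory Submission
  imports Defs
begin

section \<open>The Schauder system on the half-line\<close>

text \<open>The primitive of the indicator of [0,1]. Hence \<open>ramp (x - k)\<close> is the length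
  of the part of [k,k+1] to the left of x.\<close>

definition ramp :: "real \<Rightarrow> real" where
  "ramp x = max 0 (min 1 x)"

text \<open>Level 0 integrates the indicators of the unit intervals. Level \<open>Suc n\<close>
  integrates the Haar function of height 2^(n/2) on [k/2^n, (k+1)/2^n], which gives a hat of height
  2^(-n/2)/2 at the midpoint.\<close>

fun schauder :: "nat \<Rightarrow> nat \<Rightarrow> real \<Rightarrow> real" where
  "schauder 0 k t = ramp (t - real k)"
| "schauder (Suc n) k t =
     sqrt (1/2) ^ n / 2 *
       (ramp (2 ^ Suc n * t - real (2 * k)) - ramp (2 ^ Suc n * t - real (2 * k + 1)))"

lemma ramp_nonneg: "0 \<le> ramp x" and ramp_le_1: "ramp x \<le> 1" and ramp_mono: "x \<le> y \<Longrightarrow> ramp x \<le> ramp y"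
  by (auto simp: ramp_def)

lemma ramp_eq_0: "x \<le> 0 \<Longrightarrow> ramp x = 0"
  by (auto simp: ramp_def)

text \<open>Two-scale relation: the unit interval is the union of its two halves.\<close>

lemma ramp_refine: "ramp x = (ramp (2 * x) + ramp (2 * x - 1)) / 2"
  by (auto simp: ramp_def max_def min_def)

lemma continuous_on_schauder: "continuous_on A (schauder n k)"
  by (cases n) (auto simp: ramp_def intro!: continuous_intros)

lemma schauder_eq_0:
  assumes "2 ^ (n - 1) * t \<le> real k"
  shows "schauder n k t = 0"
proof (cases n)
  case 0
  then show ?thesis using assms by (simp add: ramp_eq_0)
next
  case (Suc m)
  then have "2 ^ Suc m * t - real (2 * k) \<le> 0" "2 ^ Suc m * t - real (2 * k + 1) \<le> 0"
    using assms by auto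
  then show ?thesis unfolding Suc schauder.simps by (simp only: ramp_eq_0) simp
qed

lemma sum_lessThan_double: "(\<Sum>k<2 * m. f k) = (\<Sum>k<m. f (2 * k) + f (2 * k + 1))"
  for f :: "nat \<Rightarrow> 'a :: comm_monoid_add"
  by (induction m) (simp_all add: add.assoc)

text \<open>Hats of one level have disjoint supports, so their sum never exceeds a single height.
  Instead of locating t, the proof sees the hats as every second term of a telescoping sum of
  nonnegative differences with total at most 1.\<close>

lemma sum_abs_schauder_le: "(\<Sum>k<m. \<bar>schauder (Suc n) k t\<bar>) \<le> sqrt (1/2) ^ n / 2"
proof -
  define y where "y = 2 ^ Suc n * t"
  define d where "d k = ramp (y - real k) - ramp (y - real (Suc k))" for k
  have d: "d k \<ge> 0" for k
    unfolding d_def by (simp add: ramp_mono)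
  have "(\<Sum>k<m. d (2 * k)) \<le> (\<Sum>k<2 * m. d k)"
    unfolding sum_lessThan_double by (intro sum_mono) (use d in simp)
  also have "\<dots> = ramp (y - real 0) - ramp (y - real (2 * m))"
    unfolding d_def by (rule sum_lessThan_telescope')
  also have "\<dots> \<le> 1"
    using ramp_le_1[of "y - real 0"] ramp_nonneg[of "y - real (2 * m)"] by linarith
  finally have "(\<Sum>k<m. d (2 * k)) \<le> 1" .
  moreover have "\<bar>schauder (Suc n) k t\<bar> = sqrt (1/2) ^ n / 2 * d (2 * k)" for k
    using d[of "2 * k"] by (simp add: d_def y_def abs_mult)
  ultimately show ?thesis
    by (simp only: sum_distrib_left[symmetric]) (simp add: mult_left_le)
qed

text \<open>The parallelogram identity \<open>(a + b)(a' + b') + (a - b)(a' - b') = 2(aa' + bb')\<close> makes the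
  kernel of one dyadic level plus the next layer of hats equal to the kernel of the next level.\<close>

lemma schauder_kernel_partial_sum:
  "(\<Sum>m<Suc n. \<Sum>k<N * 2 ^ (m - 1). schauder m k s * schauder m k t) =
    (1/2) ^ n * (\<Sum>k<N * 2 ^ n. ramp (2 ^ n * s - real k) * ramp (2 ^ n * t - real k))"
proof (induction n)
  case 0
  then show ?case by simp
next
  case (Suc n)
  define u where "u k = 2 ^ Suc n * s - real k" for k :: nat
  define v where "v k = 2 ^ Suc n * t - real k" for k :: nat
  have hs: "schauder (Suc n) k s = sqrt (1/2) ^ n / 2 * (ramp (u (2 * k)) - ramp (u (2 * k + 1)))"
    and ht: "schauder (Suc n) k t = sqrt (1/2) ^ n / 2 * (ramp (v (2 * k)) - ramp (v (2 * k + 1)))" for k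
    by (simp_all add: u_def v_def)
  have sq: "sqrt (1/2) ^ n * sqrt (1/2) ^ n = (1/2 :: real) ^ n"
    by (simp flip: power_mult_distrib)
  have rs: "ramp (2 ^ n * s - real k) = (ramp (u (2 * k)) + ramp (u (2 * k + 1))) / 2"
    and rt: "ramp (2 ^ n * t - real k) = (ramp (v (2 * k)) + ramp (v (2 * k + 1))) / 2" for k
    by (subst ramp_refine, simp add: u_def v_def algebra_simps)+
  have "(1/2) ^ n * (ramp (2 ^ n * s - real k) * ramp (2 ^ n * t - real k)) +
      schauder (Suc n) k s * schauder (Suc n) k t =
    (1/2) ^ Suc n * (ramp (u (2 * k)) * ramp (v (2 * k)) + ramp (u (2 * k + 1)) * ramp (v (2 * k + 1)))" for k
  proof -
    have "schauder (Suc n) k s * schauder (Suc n) k t = (sqrt (1/2) ^ n * sqrt (1/2) ^ n) *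
        ((ramp (u (2 * k)) - ramp (u (2 * k + 1))) * (ramp (v (2 * k)) - ramp (v (2 * k + 1))) / 4)"
      unfolding hs ht by simp
    then have "schauder (Suc n) k s * schauder (Suc n) k t = (1/2) ^ n *
        ((ramp (u (2 * k)) - ramp (u (2 * k + 1))) * (ramp (v (2 * k)) - ramp (v (2 * k + 1))) / 4)"
      by (simp only: sq)
    moreover have "c * ((a + b) / 2 * ((a' + b') / 2)) + c * ((a - b) * (a' - b') / 4) =
        1/2 * c * (a * a' + b * b')" for a a' b b' c :: real
      by (simp add: field_simps)
    ultimately show ?thesis by (simp only: rs rt power_Suc)
  qed
  then have "(1/2) ^ n * (\<Sum>k<N * 2 ^ n. ramp (2 ^ n * s - real k) * ramp (2 ^ n * t - real k)) +
      (\<Sum>k<N * 2 ^ n. schauder (Suc n) k s * schauder (Suc n) k t) =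
    (1/2) ^ Suc n * (\<Sum>k<2 * (N * 2 ^ n). ramp (u k) * ramp (v k))"
    by (simp only: sum_distrib_left sum_lessThan_double flip: sum.distrib)
  then show ?case
    unfolding sum.lessThan_Suc[of _ "Suc n"] Suc.IH
    by (simp add: u_def v_def mult_ac)
qed

text \<open>The summands are the lengths of [0,x] inside successive unit intervals.\<close>

lemma sum_ramp: "0 \<le> x \<Longrightarrow> (\<Sum>k<m. ramp (x - real k)) = min x (real m)"
proof (induction m)
  case (Suc m)
  have "min x (real m) + ramp (x - real m) = min x (real (Suc m))"
    by (simp add: ramp_def)
  then show ?case using Suc by simp
qed simp

text \<open>Replacing the factor at y by 1 would give x exactly, by \<open>sum_ramp\<close>. Only
  the unit interval containing x can contribute a defect; bounding each defect by a telescoping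
  difference avoids singling that interval out.\<close>

lemma sum_ramp_mult_ramp:
  assumes "0 \<le> x" "x \<le> y" "x \<le> real m"
  shows "\<bar>(\<Sum>k<m. ramp (x - real k) * ramp (y - real k)) - x\<bar> \<le> 1"
proof -
  let ?e = "\<lambda>k. ramp (x - real k) - ramp (x - real k) * ramp (y - real k)"
  have e0: "0 \<le> ?e k" for k
    using ramp_nonneg[of "x - real k"] ramp_le_1[of "y - real k"] by (simp add: mult_left_le)
  have "?e k \<le> ramp (x - real k) - ramp (x - real (Suc k))" for k
  proof -
    have "ramp (x - real k) * ramp (x - real k) \<le> ramp (x - real k) * ramp (y - real k)"
      using assms by (intro mult_left_mono ramp_mono ramp_nonneg) auto
    \<comment> \<open>The left side is positive only where \<open>ramp (x - real k)\<close> is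
      already 1.\<close>
    moreover have "ramp (x - real (Suc k)) \<le> ramp (x - real k) * ramp (x - real k)"
      by (auto simp: ramp_def max_def min_def)
    ultimately show ?thesis by linarith
  qed
  then have "(\<Sum>k<m. ?e k) \<le> (\<Sum>k<m. ramp (x - real k) - ramp (x - real (Suc k)))"
    by (intro sum_mono)
  also have "\<dots> = ramp (x - real 0) - ramp (x - real m)"
    by (rule sum_lessThan_telescope')
  also have "\<dots> \<le> 1"
    using ramp_le_1[of "x - real 0"] ramp_nonneg[of "x - real m"] by linarith
  finally have "(\<Sum>k<m. ?e k) \<le> 1" .
  moreover have "0 \<le> (\<Sum>k<m. ?e k)"
    by (intro sum_nonneg e0)
  moreover have "(\<Sum>k<m. ?e k) = x - (\<Sum>k<m. ramp (x - real k) * ramp (y - real k))"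
    using assms by (simp add: sum_subtractf sum_ramp)
  ultimately show ?thesis by linarith
qed

text \<open>This is Parseval's identity for the indicators of [0,s] and [0,t] in the Haar basis,
  obtained by elementary means: at scale 2^n the error is at most 1, so after rescaling it is at
  most 2^(-n).\<close>

lemma schauder_kernel_tendsto:
  assumes "0 \<le> s" "0 \<le> t" "s \<le> real N" "t \<le> real N"
  shows "(\<lambda>n. \<Sum>m<Suc n. \<Sum>k<N * 2 ^ (m - 1). schauder m k s * schauder m k t)
    \<longlonglongrightarrow> min s t"
  using assms
proof (induction s t rule: linorder_wlog)
  case (le s t)
  have bound: "\<bar>(1/2) ^ n * (\<Sum>k<N * 2 ^ n. ramp (2 ^ n * s - real k) * ramp (2 ^ n * t - real k)) - s\<bar>
      \<le> (1/2) ^ n" for n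
  proof -
    let ?S = "\<Sum>k<N * 2 ^ n. ramp (2 ^ n * s - real k) * ramp (2 ^ n * t - real k)"
    have "\<bar>?S - 2 ^ n * s\<bar> \<le> 1"
      using le by (intro sum_ramp_mult_ramp) (auto simp: mult.commute)
    then have "(1/2) ^ n * \<bar>?S - 2 ^ n * s\<bar> \<le> (1/2) ^ n"
      by (simp add: mult_left_le)
    moreover have "(1/2) ^ n * \<bar>?S - 2 ^ n * s\<bar> = \<bar>(1/2) ^ n * (?S - 2 ^ n * s)\<bar>"
      by (simp add: abs_mult)
    moreover have "(1/2) ^ n * (?S - 2 ^ n * s) = (1/2) ^ n * ?S - s"
      by (simp add: algebra_simps power_one_over)
    ultimately show ?thesis by simp
  qed
  have "(\<lambda>n. (1/2) ^ n * (\<Sum>k<N * 2 ^ n. ramp (2 ^ n * s - real k) * ramp (2 ^ n * t - real k)) - s)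
      \<longlonglongrightarrow> 0"
  proof (rule Lim_null_comparison)
    show "(\<lambda>n. (1/2 :: real) ^ n) \<longlonglongrightarrow> 0"
      by (rule LIMSEQ_realpow_zero) simp_all
  qed (simp only: real_norm_def bound eventually_True)
  then show ?case
    unfolding schauder_kernel_partial_sum min_absorb1[OF \<open>s \<le> t\<close>] by (rule LIM_zero_cancel)
next
  case (sym s t)
  then show ?case by (simp add: min.commute mult.commute)
qed

section \<open>Centred normal variables through characteristic functions\<close>

text \<open>By Levy's uniqueness theorem the law is a point mass at 0 if v = 0; otherwise dividing
  by the square root of v gives a standard normal variable.\<close>

lemma (in prob_space) centred_normal_if_char:
  assumes X [measurable]: "X \<in> borel_measurable M"
    and char: "\<And>\<theta>. char (distr M borel X) \<theta> = complex_of_real (exp (- v * \<theta>\<^sup>2 / 2))"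
  shows "normally_distributed M X" "integrable M (\<lambda>\<omega>. (X \<omega>)\<^sup>2)"
    "expectation X = 0" "expectation (\<lambda>\<omega>. (X \<omega>)\<^sup>2) = v"
proof -
  interpret X: real_distribution "distr M borel X"
    by (rule real_distribution_distr) (rule X)
  \<comment> \<open>A negative v would make the characteristic function exceed 1 in modulus at
    1.\<close>
  have "0 \<le> v"
    using X.cmod_char_le_1[of 1] by (simp add: char)
  have "normally_distributed M X \<and> integrable M (\<lambda>\<omega>. (X \<omega>)\<^sup>2) \<and>
    expectation X = 0 \<and> expectation (\<lambda>\<omega>. (X \<omega>)\<^sup>2) = v"
  proof (cases "v = 0")
    case True
    have "char (distr M borel X) = char (return borel 0)"
      by (intro ext, subst char) (simp add: True char_def integral_return)
    then have "distr M borel X = return borel 0"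
      by (intro Levy_uniqueness) (auto simp: real_distribution_def real_distribution_axioms_def
          intro: prob_space_return prob_space_distr)
    moreover have "AE x in return borel 0. x = (0 :: real)"
      by (subst AE_return) auto
    ultimately have "AE x in distr M borel X. x = 0"
      by (simp only:)
    then have AE: "AE \<omega> in M. X \<omega> = 0"
      by (subst (asm) AE_distr_iff) auto
    then have AE2: "AE \<omega> in M. (X \<omega>)\<^sup>2 = 0"
      by eventually_elim simp
    have "integrable M (\<lambda>\<omega>. (X \<omega>)\<^sup>2)"
      using AE2 by (subst integrable_cong_AE[of _ _ "\<lambda>_. 0"]) simp_all
    moreover have "expectation (\<lambda>\<omega>. (X \<omega>)\<^sup>2) = 0" "expectation X = 0"
      using AE AE2 by (simp_all add: integral_eq_zero_AE)
    ultimately show ?thesis using AE X True unfolding normally_distributed_def by blast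
  next
    case False
    define \<sigma> where "\<sigma> = sqrt v"
    have \<sigma>: "0 < \<sigma>" "\<sigma>\<^sup>2 = v" using False \<open>0 \<le> v\<close> by (auto simp: \<sigma>_def)
    \<comment> \<open>The subtraction of 0 matches the standardised form in
      \<open>normal_standard_normal_convert\<close> with mean 0.\<close>
    have "char (distr M borel (\<lambda>\<omega>. (X \<omega> - 0) / \<sigma>)) \<theta> = char std_normal_distribution \<theta>" for \<theta>
    proof -
      have "char (distr M borel (\<lambda>\<omega>. (X \<omega> - 0) / \<sigma>)) \<theta> = char (distr M borel X) (\<theta> / \<sigma>)"
        by (simp add: char_def integral_distr mult_ac)
      then show ?thesis using \<sigma> False
        by (simp add: char char_std_normal_distribution power_divide)
    qed
    then have "distr M borel (\<lambda>\<omega>. (X \<omega> - 0) / \<sigma>) = std_normal_distribution"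
      by (intro Levy_uniqueness real_dist_normal_dist ext)
        (auto simp: real_distribution_def real_distribution_axioms_def intro: prob_space_distr)
    then have "distributed M lborel (\<lambda>\<omega>. (X \<omega> - 0) / \<sigma>) std_normal_density"
      unfolding distributed_def by (auto cong: distr_cong)
    then have D: "distributed M lborel X (normal_density 0 \<sigma>)"
      using normal_standard_normal_convert[of \<sigma> X 0] \<sigma> by simp
    have E: "expectation X = 0"
      using normal_distributed_expectation[OF \<sigma>(1) D] .
    have V: "expectation (\<lambda>\<omega>. (X \<omega>)\<^sup>2) = v"
      using normal_distributed_variance[OF \<sigma>(1) D] E \<sigma> by simp
    \<comment> \<open>A non-integrable function has integral 0 by convention, so the nonzero value v
      forces integrability.\<close>
    then have "integrable M (\<lambda>\<omega>. (X \<omega>)\<^sup>2)"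
      using False not_integrable_integral_eq by fastforce
    then show ?thesis using E V D \<sigma> by (auto simp: normally_distributed_def)
  qed
  then show "normally_distributed M X" "integrable M (\<lambda>\<omega>. (X \<omega>)\<^sup>2)"
    "expectation X = 0" "expectation (\<lambda>\<omega>. (X \<omega>)\<^sup>2) = v"
    by auto
qed

text \<open>Dominated convergence applies with majorant 1, since \<open>iexp\<close> of a real
  number has modulus 1.\<close>

lemma (in prob_space) char_AE_tendsto:
  assumes X [measurable]: "X \<in> borel_measurable M" and Y [measurable]: "\<And>n. Y n \<in> borel_measurable M"
    and lim: "AE \<omega> in M. (\<lambda>n. Y n \<omega>) \<longlonglongrightarrow> X \<omega>"
  shows "(\<lambda>n. char (distr M borel (Y n)) \<theta>) \<longlonglongrightarrow> char (distr M borel X) \<theta>"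
proof -
  have "(\<lambda>n. \<integral>\<omega>. iexp (\<theta> * Y n \<omega>) \<partial>M) \<longlonglongrightarrow> (\<integral>\<omega>. iexp (\<theta> * X \<omega>) \<partial>M)"
  proof (rule integral_dominated_convergence[where w = "\<lambda>_. 1"])
    show "AE \<omega> in M. (\<lambda>n. iexp (\<theta> * Y n \<omega>)) \<longlonglongrightarrow> iexp (\<theta> * X \<omega>)"
      using lim by eventually_elim (intro tendsto_intros)
  qed auto
  then show ?thesis by (simp add: char_def integral_distr)
qed

section \<open>The Gaussian series\<close>

text \<open>Coefficients are indexed by level and position, as in \<open>schauder\<close>. The
  probability space stays abstract until the final construction.\<close>

locale gaussian_noise = prob_space +
  fixes Z :: "nat \<times> nat \<Rightarrow> 'a \<Rightarrow> real"
  assumes indep: "indep_vars (\<lambda>_. borel) Z UNIV"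
    and std_normal: "\<And>p. distr M borel (Z p) = std_normal_distribution"
begin

lemma measurable_Z [measurable]: "Z p \<in> borel_measurable M"
  using indep by (cases p) (auto simp: indep_vars_def)

text \<open>Independence makes the characteristic function a product of Gaussian factors, whose
  exponents add.\<close>

lemma char_linear_combination:
  assumes "finite J"
  shows "char (distr M borel (\<lambda>\<omega>. \<Sum>p\<in>J. b p * Z p \<omega>)) \<theta> =
    complex_of_real (exp (- (\<Sum>p\<in>J. (b p)\<^sup>2) * \<theta>\<^sup>2 / 2))"
proof -
  have "indep_vars (\<lambda>_. borel) (\<lambda>p \<omega>. b p * Z p \<omega>) J"
    by (rule indep_vars_compose2[where X = Z, OF indep_vars_subset[OF indep]]) auto
  then have "char (distr M borel (\<lambda>\<omega>. \<Sum>p\<in>J. b p * Z p \<omega>)) \<theta> =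
      (\<Prod>p\<in>J. char (distr M borel (\<lambda>\<omega>. b p * Z p \<omega>)) \<theta>)"
    by (rule char_distr_sum)
  also have "\<dots> = (\<Prod>p\<in>J. complex_of_real (exp (- (b p)\<^sup>2 * \<theta>\<^sup>2 / 2)))"
  proof (rule prod.cong[OF refl])
    fix p
    show "char (distr M borel (\<lambda>\<omega>. b p * Z p \<omega>)) \<theta> = complex_of_real (exp (- (b p)\<^sup>2 * \<theta>\<^sup>2 / 2))"
    proof -
      have "char (distr M borel (\<lambda>\<omega>. b p * Z p \<omega>)) \<theta> = char (distr M borel (Z p)) (\<theta> * b p)"
        by (simp add: char_def integral_distr mult_ac)
      then show ?thesis
        by (simp add: std_normal char_std_normal_distribution power_mult_distrib mult_ac)
    qed
  qed
  also have "(\<Prod>p\<in>J. complex_of_real (exp (- (b p)\<^sup>2 * \<theta>\<^sup>2 / 2))) =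
      complex_of_real (exp (- (\<Sum>p\<in>J. (b p)\<^sup>2) * \<theta>\<^sup>2 / 2))"
    using assms by (simp flip: of_real_prod exp_sum
        add: sum_negf sum_divide_distrib sum_distrib_right)
  finally show ?thesis .
qed

section \<open>Almost sure growth of the coefficients\<close>

lemma moment8: "integrable M (\<lambda>\<omega>. Z p \<omega> ^ 8)" "expectation (\<lambda>\<omega>. Z p \<omega> ^ 8) = 105"
proof -
  have "integrable (distr M borel (Z p)) (\<lambda>x. x ^ 8)"
    unfolding std_normal by (rule integrable_std_normal_distribution_moment)
  then show "integrable M (\<lambda>\<omega>. Z p \<omega> ^ 8)"
    by (subst (asm) integrable_distr_eq) auto
  \<comment> \<open>The moment of order 2k is (2k)! / (2^k k!); for k = 4 this is 7 * 5 * 3 *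
    1.\<close>
  have "(\<integral>x. x ^ 8 \<partial>distr M borel (Z p)) = 105"
    unfolding std_normal using std_normal_distribution_even_moments(1)[of 4]
    by (simp add: fact_numeral)
  then show "expectation (\<lambda>\<omega>. Z p \<omega> ^ 8) = 105"
    by (subst (asm) integral_distr) auto
qed

text \<open>The range 4^n serves all bounded time intervals at once, since it eventually exceeds
  every N * 2^n. The base 6/5 is small enough that 6/5 * sqrt (1/2) < 1, which makes the series
  converge, and large enough for Borel-Cantelli.\<close>

definition tame :: "'a \<Rightarrow> bool" where
  "tame \<omega> \<longleftrightarrow> (\<exists>m. \<forall>n\<ge>m. \<forall>k<4 ^ n. \<bar>Z (n, k) \<omega>\<bar> \<le> (6/5) ^ n)"

lemma measurable_tame [measurable]: "Measurable.pred M tame"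
  unfolding tame_def by measurable

text \<open>The eighth moment suffices in Markov's inequality since \<open>(6/5)\<^sup>8 > 4\<close>.\<close>

lemma AE_tame: "AE \<omega> in M. tame \<omega>"
proof -
  define A where "A n k = {\<omega> \<in> space M. (6/5) ^ (8 * n) \<le> Z (n, k) \<omega> ^ 8}" for n k
  have [measurable]: "A n k \<in> sets M" for n k
    unfolding A_def by measurable
  have A: "prob (A n k) \<le> 105 / (6/5) ^ (8 * n)" for n k
    unfolding A_def
    using integral_Markov_inequality_measure[OF moment8(1)[of "(n, k)"], of "space M" "(6/5) ^ (8 * n)"]
    by (simp add: moment8)
  have bound: "prob (\<Union>k<4^n. A n k) \<le> 105 * (4 / (6/5) ^ 8) ^ n" for n
  proof -
    have "prob (\<Union>k<4^n. A n k) \<le> (\<Sum>k<4^n. prob (A n k))"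
      by (rule finite_measure_subadditive_finite) auto
    also have "\<dots> \<le> (\<Sum>k<4^n::nat. 105 / (6/5) ^ (8 * n))"
      by (intro sum_mono A)
    also have "\<dots> = 4 ^ n * (105 / ((6/5) ^ 8) ^ n)"
      by (simp only: sum_constant card_lessThan power_mult of_nat_power of_nat_numeral)
    also have "\<dots> = 105 * (4 / (6/5) ^ 8) ^ n"
      by (simp only: power_divide[of 4]) (simp only: times_divide_eq_right mult.commute)
    finally show ?thesis .
  qed
  have "summable (\<lambda>n. 105 * (4 / (6/5) ^ 8 :: real) ^ n)"
    by (rule summable_mult[OF summable_geometric]) (simp add: power_divide)
  then have "summable (\<lambda>n. prob (\<Union>k<4^n. A n k))"
    by (rule summable_comparison_test'[where N = 0])
      (simp only: real_norm_def abs_of_nonneg[OF measure_nonneg] bound)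
  then have "AE \<omega> in M. eventually (\<lambda>n. \<omega> \<in> space M - (\<Union>k<4^n. A n k)) sequentially"
    by (intro borel_cantelli_AE1) (auto simp: less_top[symmetric])
  then show ?thesis
  proof eventually_elim
    case (elim \<omega>)
    then obtain m where m: "\<And>n. n \<ge> m \<Longrightarrow> \<omega> \<in> space M - (\<Union>k<4^n. A n k)"
      by (auto simp: eventually_sequentially)
    have "\<bar>Z (n, k) \<omega>\<bar> \<le> (6/5) ^ n" if "n \<ge> m" "k < 4 ^ n" for n k
    proof (rule ccontr)
      assume "\<not> ?thesis"
      then have "((6/5) ^ n) ^ 8 \<le> \<bar>Z (n, k) \<omega>\<bar> ^ 8"
        by (intro power_mono) auto
      then have "(6/5) ^ (8 * n) \<le> Z (n, k) \<omega> ^ 8"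
        by (simp add: power_even_abs mult.commute flip: power_mult)
      then show False using m[OF that(1)] that(2) by (auto simp: A_def)
    qed
    then show ?case unfolding tame_def by blast
  qed
qed

text \<open>The cut-off drops only vanishing terms: level \<open>0\<close> consists of unit ramps, and level \<open>n > 0\<close> of
  hats on the intervals \<open>[k / 2\<^sup>n\<^sup>-\<^sup>1, (k + 1) / 2\<^sup>n\<^sup>-\<^sup>1]\<close>; truncated subtraction makes \<open>2 ^ (n - 1)\<close> right
  for both.\<close>

definition layer :: "nat \<Rightarrow> real \<Rightarrow> 'a \<Rightarrow> real" where
  "layer n t \<omega> = (\<Sum>k<nat \<lceil>2 ^ (n - 1) * t\<rceil>. schauder n k t * Z (n, k) \<omega>)"

text \<open>A summation range common to all times up to N allows different times to be combined and
  continuity in t to be read off.\<close>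

lemma layer_eq:
  assumes "t \<le> real N"
  shows "layer n t \<omega> = (\<Sum>k<N * 2 ^ (n - 1). schauder n k t * Z (n, k) \<omega>)"
  unfolding layer_def
proof (rule sum.mono_neutral_left)
  have "2 ^ (n - 1) * t \<le> real (N * 2 ^ (n - 1))"
    using assms by (simp add: mult.commute)
  then have "nat \<lceil>2 ^ (n - 1) * t\<rceil> \<le> N * 2 ^ (n - 1)"
    by linarith
  then show "{..<nat \<lceil>2 ^ (n - 1) * t\<rceil>} \<subseteq> {..<N * 2 ^ (n - 1)}"
    by auto
  show "\<forall>k\<in>{..<N * 2 ^ (n - 1)} - {..<nat \<lceil>2 ^ (n - 1) * t\<rceil>}. schauder n k t * Z (n, k) \<omega> = 0"
  proof
    fix k assume "k \<in> {..<N * 2 ^ (n - 1)} - {..<nat \<lceil>2 ^ (n - 1) * t\<rceil>}"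
    then have "nat \<lceil>2 ^ (n - 1) * t\<rceil> \<le> k" by simp
    then have "2 ^ (n - 1) * t \<le> real k" by linarith
    then show "schauder n k t * Z (n, k) \<omega> = 0" by (simp add: schauder_eq_0)
  qed
qed simp

lemma measurable_layer [measurable]: "layer n t \<in> borel_measurable M"
  unfolding layer_def by measurable

text \<open>The hats of level \<open>Suc n\<close> sum to at most sqrt (1/2)^n / 2 and the
  coefficients are at most (6/5)^(n+1), which leaves the factor 1/2 * 6/5 = 3/5 to spare.\<close>

lemma layer_bound:
  assumes "tame \<omega>"
  shows "\<exists>m. \<forall>n\<ge>m. \<forall>t\<in>{..<real N}. \<bar>layer (Suc n) t \<omega>\<bar> \<le> (6/5 * sqrt (1/2)) ^ n"
proof -
  obtain m where m: "\<And>n k. n \<ge> m \<Longrightarrow> k < 4 ^ n \<Longrightarrow> \<bar>Z (n, k) \<omega>\<bar> \<le> (6/5) ^ n"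
    using assms by (auto simp: tame_def)
  have "\<bar>layer (Suc n) t \<omega>\<bar> \<le> (6/5 * sqrt (1/2)) ^ n" if "n \<ge> max m N" "t < real N" for n t
  proof -
    \<comment> \<open>This places all N * 2^n positions within the range controlled by
      \<open>tame\<close>.\<close>
    have "N \<le> 2 ^ n"
      using that less_exp[of n] by linarith
    then have "N * 2 ^ n \<le> 2 ^ n * 2 ^ n"
      by (rule mult_right_mono) simp
    also have "\<dots> \<le> (4 :: nat) ^ Suc n"
      by (simp flip: power_mult_distrib)
    finally have N: "N * 2 ^ n \<le> 4 ^ Suc n" .
    have "\<bar>layer (Suc n) t \<omega>\<bar> \<le> (\<Sum>k<N * 2 ^ n. \<bar>schauder (Suc n) k t\<bar> * \<bar>Z (Suc n, k) \<omega>\<bar>)"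
      unfolding layer_eq[OF less_imp_le[OF that(2)]] by (simp flip: abs_mult del: schauder.simps)
    also have "\<dots> \<le> (\<Sum>k<N * 2 ^ n. \<bar>schauder (Suc n) k t\<bar> * (6/5) ^ Suc n)"
      using N that by (intro sum_mono mult_left_mono m) auto
    also have "\<dots> = (\<Sum>k<N * 2 ^ n. \<bar>schauder (Suc n) k t\<bar>) * (6/5) ^ Suc n"
      by (simp only: sum_distrib_right)
    also have "\<dots> \<le> sqrt (1/2) ^ n / 2 * (6/5) ^ Suc n"
      by (intro mult_right_mono sum_abs_schauder_le) auto
    also have "\<dots> = 3/5 * (6/5 * sqrt (1/2)) ^ n"
      by (simp only: power_mult_distrib power_Suc) simp
    also have "\<dots> \<le> (6/5 * sqrt (1/2)) ^ n"
      by (rule mult_left_le_one_le) simp_all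
    finally show ?thesis .
  qed
  then show ?thesis
    by (intro exI[of _ "max m N"] allI impI ballI) (simp only: lessThan_iff)
qed

section \<open>Uniform convergence and continuity of paths\<close>

definition brownian :: "real \<Rightarrow> 'a \<Rightarrow> real" where
  "brownian t \<omega> = (if tame \<omega> then \<Sum>n. layer n t \<omega> else 0)"

lemma measurable_brownian [measurable]: "brownian t \<in> borel_measurable M"
  unfolding brownian_def by measurable

lemma uniform_limit_layers:
  assumes "tame \<omega>"
  shows "uniform_limit {..<real N} (\<lambda>n t. \<Sum>i<n. layer i t \<omega>) (\<lambda>t. brownian t \<omega>) sequentially"
proof -
  obtain m where m: "\<And>n t. n \<ge> m \<Longrightarrow> t < real N \<Longrightarrow> \<bar>layer (Suc n) t \<omega>\<bar> \<le> (6/5 * sqrt (1/2)) ^ n"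
    using layer_bound[OF assms, of N] by auto
  have "\<bar>layer n t \<omega>\<bar> \<le> (6/5 * sqrt (1/2)) ^ (n - 1)" if "n \<ge> Suc m" "t < real N" for n t
    using m[of "n - 1" t] that by (cases n) auto
  then have "\<forall>\<^sub>F n in sequentially. \<forall>t\<in>{..<real N}. norm (layer n t \<omega>) \<le> (6/5 * sqrt (1/2)) ^ (n - 1)"
    by (auto simp: eventually_sequentially intro!: exI[of _ "Suc m"])
  \<comment> \<open>Since 1/2 < 25/36, the ratio 6/5 * sqrt (1/2) of the majorising geometric series
    is below 1.\<close>
  moreover have "sqrt (1/2) < (5/6 :: real)"
    by (rule real_less_lsqrt) (auto simp: power2_eq_square)
  then have "summable (\<lambda>n. (6/5 * sqrt (1/2)) ^ (n - 1))"
    by (subst summable_Suc_iff[symmetric]) simp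
  ultimately show ?thesis
    unfolding brownian_def using assms by (simp add: Weierstrass_m_test_ev)
qed

text \<open>The uniform limit is continuous on each half-line \<open>{..<real N}\<close>. These sets
  are open and cover the real line, so continuity extends to their union.\<close>

lemma continuous_on_brownian: "continuous_on A (\<lambda>t. brownian t \<omega>)"
proof (cases "tame \<omega>")
  case True
  have "continuous_on {..<real N} (\<lambda>t. brownian t \<omega>)" for N
  proof (rule uniform_limit_theorem[OF _ uniform_limit_layers[OF True]])
    \<comment> \<open>The number of summands in \<open>layer\<close> depends on t; continuity is
      therefore proved for a fixed range and transferred by \<open>layer_eq\<close>.\<close>
    have "continuous_on {..<real N} (\<lambda>t. \<Sum>k<N * 2 ^ (i - 1). schauder i k t * Z (i, k) \<omega>)" for i
      by (intro continuous_intros continuous_on_schauder)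
    then have "continuous_on {..<real N} (\<lambda>t. layer i t \<omega>)" for i
      by (rule continuous_on_cong[THEN iffD1, rotated -1]) (auto simp: layer_eq[of _ N])
    then show "\<forall>\<^sub>F n in sequentially. continuous_on {..<real N} (\<lambda>t. \<Sum>i<n. layer i t \<omega>)"
      by (intro always_eventually allI continuous_on_sum)
  qed auto
  then have "continuous_on (\<Union>N. {..<real N}) (\<lambda>t. brownian t \<omega>)"
    by (intro continuous_on_open_UN) auto
  moreover have "(\<Union>N. {..<real N}) = UNIV"
    using reals_Archimedean2 by auto
  ultimately show ?thesis by (auto intro: continuous_on_subset)
qed (simp add: brownian_def)

section \<open>Finite-dimensional laws\<close>

lemma layers_tendsto_brownian:
  assumes "tame \<omega>"
  shows "(\<lambda>n. \<Sum>i<n. layer i t \<omega>) \<longlonglongrightarrow> brownian t \<omega>"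
proof -
  obtain N where "t < real N" using reals_Archimedean2 by blast
  then show ?thesis using tendsto_uniform_limitI[OF uniform_limit_layers[OF assms, of N]] by auto
qed

text \<open>Truncating the series at level n leaves a finite combination of the coefficients, whose
  variance is the quadratic form of the truncated kernel. The limit can be taken both in that
  variance and along almost every path; the two results must agree.\<close>

lemma char_brownian_combination:
  assumes "finite I" "\<And>i. i \<in> I \<Longrightarrow> 0 \<le> t i"
  shows "char (distr M borel (\<lambda>\<omega>. \<Sum>i\<in>I. c i * brownian (t i) \<omega>)) \<theta> =
    complex_of_real (exp (- (\<Sum>i\<in>I. \<Sum>j\<in>I. c i * c j * min (t i) (t j)) * \<theta>\<^sup>2 / 2))"
proof -
  \<comment> \<open>Inserting 0 keeps the maximum meaningful for empty \<open>I\<close>.\<close>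
  obtain N :: nat where "Max (insert 0 (t ` I)) \<le> real N"
    using real_arch_simple by blast
  then have N: "t i \<le> real N" if "i \<in> I" for i
    using that assms by (auto simp: Max_le_iff)
  define J where "J n = (SIGMA m:{..<Suc n}. {..<N * 2 ^ (m - 1)})" for n
  define h where "h p u = schauder (fst p) (snd p) u" for p u
  define b where "b p = (\<Sum>i\<in>I. c i * h p (t i))" for p
  define Y where "Y = (\<lambda>n \<omega>. \<Sum>p\<in>J n. b p * Z p \<omega>)"
  have J: "finite (J n)" for n unfolding J_def by auto
  have Y: "Y n \<omega> = (\<Sum>i\<in>I. c i * (\<Sum>m<Suc n. layer m (t i) \<omega>))" for n \<omega>
  proof -
    have "(\<Sum>m<Suc n. layer m (t i) \<omega>) = (\<Sum>p\<in>J n. h p (t i) * Z p \<omega>)" if "i \<in> I" for i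
      unfolding J_def h_def layer_eq[OF N[OF that]]
      by (subst sum.Sigma) (auto intro!: sum.cong)
    then have "(\<Sum>i\<in>I. c i * (\<Sum>m<Suc n. layer m (t i) \<omega>)) = (\<Sum>i\<in>I. c i * (\<Sum>p\<in>J n. h p (t i) * Z p \<omega>))"
      by simp
    also have "\<dots> = (\<Sum>i\<in>I. \<Sum>p\<in>J n. c i * h p (t i) * Z p \<omega>)"
      by (simp add: sum_distrib_left mult.assoc)
    also have "\<dots> = Y n \<omega>"
      unfolding Y_def b_def sum_distrib_right by (rule sum.swap)
    finally show ?thesis by simp
  qed
  have kernel: "(\<Sum>p\<in>J n. h p u * h p v) =
      (\<Sum>m<Suc n. \<Sum>k<N * 2 ^ (m - 1). schauder m k u * schauder m k v)" for n u v
    unfolding J_def h_def by (subst sum.Sigma) (auto intro!: sum.cong)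
  have var: "(\<Sum>p\<in>J n. (b p)\<^sup>2) = (\<Sum>i\<in>I. \<Sum>j\<in>I. c i * c j *
      (\<Sum>m<Suc n. \<Sum>k<N * 2 ^ (m - 1). schauder m k (t i) * schauder m k (t j)))" for n
  proof -
    have "(\<Sum>p\<in>J n. (b p)\<^sup>2) = (\<Sum>p\<in>J n. \<Sum>i\<in>I. \<Sum>j\<in>I. c i * c j * (h p (t i) * h p (t j)))"
      unfolding b_def power2_eq_square sum_product by (simp add: mult_ac)
    also have "\<dots> = (\<Sum>i\<in>I. \<Sum>j\<in>I. \<Sum>p\<in>J n. c i * c j * (h p (t i) * h p (t j)))"
      by (subst sum.swap, intro sum.cong refl, subst sum.swap, rule refl)
    also have "\<dots> = (\<Sum>i\<in>I. \<Sum>j\<in>I. c i * c j * (\<Sum>p\<in>J n. h p (t i) * h p (t j)))"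
      by (simp add: sum_distrib_left)
    finally show ?thesis unfolding kernel .
  qed
  have "(\<lambda>n. \<Sum>p\<in>J n. (b p)\<^sup>2) \<longlonglongrightarrow> (\<Sum>i\<in>I. \<Sum>j\<in>I. c i * c j * min (t i) (t j))"
    unfolding var using assms N by (intro tendsto_intros schauder_kernel_tendsto)
  then have "(\<lambda>n. complex_of_real (exp (- (\<Sum>p\<in>J n. (b p)\<^sup>2) * \<theta>\<^sup>2 / 2))) \<longlonglongrightarrow>
      complex_of_real (exp (- (\<Sum>i\<in>I. \<Sum>j\<in>I. c i * c j * min (t i) (t j)) * \<theta>\<^sup>2 / 2))"
    by (intro tendsto_intros) auto
  then have "(\<lambda>n. char (distr M borel (Y n)) \<theta>) \<longlonglongrightarrow>
      complex_of_real (exp (- (\<Sum>i\<in>I. \<Sum>j\<in>I. c i * c j * min (t i) (t j)) * \<theta>\<^sup>2 / 2))"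
    unfolding Y_def char_linear_combination[OF J] .
  moreover have "(\<lambda>n. char (distr M borel (Y n)) \<theta>) \<longlonglongrightarrow>
      char (distr M borel (\<lambda>\<omega>. \<Sum>i\<in>I. c i * brownian (t i) \<omega>)) \<theta>"
  proof (rule char_AE_tendsto)
    show "AE \<omega> in M. (\<lambda>n. Y n \<omega>) \<longlonglongrightarrow> (\<Sum>i\<in>I. c i * brownian (t i) \<omega>)"
      using AE_tame
    proof eventually_elim
      case (elim \<omega>)
      show ?case unfolding Y
        by (intro tendsto_intros LIMSEQ_Suc layers_tendsto_brownian elim)
    qed
  qed (simp_all add: Y_def)
  ultimately show ?thesis by (rule LIMSEQ_unique[symmetric])
qed

text \<open>The index type is left general: a one-point type yields the variances, the Booleans the
  covariances, and an arbitrary finite \<open>I\<close> the random vectors.\<close>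

lemma brownian_normal:
  fixes c :: "'i \<Rightarrow> real"
  assumes "finite I" "\<And>i. i \<in> I \<Longrightarrow> 0 \<le> t i"
  defines "X \<equiv> \<lambda>\<omega>. \<Sum>i\<in>I. c i * brownian (t i) \<omega>"
  shows "normally_distributed M X" "integrable M (\<lambda>\<omega>. (X \<omega>)\<^sup>2)" "expectation X = 0"
    "expectation (\<lambda>\<omega>. (X \<omega>)\<^sup>2) = (\<Sum>i\<in>I. \<Sum>j\<in>I. c i * c j * min (t i) (t j))"
proof -
  let ?v = "\<Sum>i\<in>I. \<Sum>j\<in>I. c i * c j * min (t i) (t j)"
  have X: "X \<in> borel_measurable M"
    unfolding X_def by measurable
  have char: "char (distr M borel X) \<theta> = complex_of_real (exp (- ?v * \<theta>\<^sup>2 / 2))" for \<theta>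
    unfolding X_def by (rule char_brownian_combination[OF assms(1,2)])
  note normal = centred_normal_if_char[OF X char]
  show "normally_distributed M X" "integrable M (\<lambda>\<omega>. (X \<omega>)\<^sup>2)" "expectation X = 0"
    "expectation (\<lambda>\<omega>. (X \<omega>)\<^sup>2) = ?v"
    by (fact normal)+
qed

lemma
  assumes "0 \<le> t"
  shows square_integrable_brownian: "integrable M (\<lambda>\<omega>. (brownian t \<omega>)\<^sup>2)"
    and expectation_brownian: "expectation (brownian t) = 0"
    and expectation_brownian_square: "expectation (\<lambda>\<omega>. (brownian t \<omega>)\<^sup>2) = t"
  using brownian_normal(2-4)[where I = "{()}" and t = "\<lambda>_. t" and c = "\<lambda>_. 1"] assms
  by simp_all

text \<open>Polarisation: the sum of the two values has second moment s + t + 2 * min s t.\<close>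

lemma expectation_brownian_mult:
  assumes "0 \<le> s" "0 \<le> t"
  shows "expectation (\<lambda>\<omega>. brownian s \<omega> * brownian t \<omega>) = min s t"
proof -
  \<comment> \<open>Indexing by Booleans, not by the times themselves, keeps two summands when s =
    t.\<close>
  let ?u = "\<lambda>b. if b then s else t"
  have eq: "brownian s \<omega> * brownian t \<omega> =
      ((\<Sum>b\<in>UNIV. 1 * brownian (?u b) \<omega>)\<^sup>2 - (brownian s \<omega>)\<^sup>2 - (brownian t \<omega>)\<^sup>2) / 2" for \<omega>
    by (simp add: UNIV_bool power2_eq_square algebra_simps)
  have "expectation (\<lambda>\<omega>. brownian s \<omega> * brownian t \<omega>) =
      (expectation (\<lambda>\<omega>. (\<Sum>b\<in>UNIV. 1 * brownian (?u b) \<omega>)\<^sup>2) - s - t) / 2"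
    unfolding eq using assms brownian_normal(2)[of UNIV ?u "\<lambda>_. 1"]
    by (simp add: square_integrable_brownian expectation_brownian_square)
  also have "\<dots> = min s t"
    by (subst brownian_normal(4)) (use assms in \<open>auto simp: UNIV_bool min.commute\<close>)
  finally show ?thesis .
qed

lemma multivariate_normal_brownian:
  assumes "finite I" "\<And>i. i \<in> I \<Longrightarrow> 0 \<le> t i"
  shows "multivariate_normal M I (\<lambda>i. brownian (t i)) (\<lambda>i. 0) (\<lambda>i j. min (t i) (t j))"
  using assms unfolding multivariate_normal_def covariance_def
  by (simp add: prob_space_axioms brownian_normal expectation_brownian expectation_brownian_mult)

text \<open>At time 0 every layer is an empty sum.\<close>

lemma AE_brownian_0: "AE \<omega> in M. brownian 0 \<omega> = 0"
  by (simp add: brownian_def layer_def)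

end

section \<open>Realising the noise on a product space\<close>

lemma gaussian_noise_PiM:
  fixes e :: "nat \<times> nat \<Rightarrow> 'i"
  assumes "inj e"
  shows "gaussian_noise (PiM UNIV (\<lambda>_ :: 'i. std_normal_distribution)) (\<lambda>p \<omega>. \<omega> (e p))"
proof -
  let ?N = "\<lambda>_ :: 'i. std_normal_distribution"
  interpret N: prob_space std_normal_distribution
    using prob_space_normal_density by simp
  interpret P: prob_space "PiM UNIV ?N"
    by (intro prob_space_PiM) (rule N.prob_space_axioms)
  have [measurable]: "(\<lambda>\<omega>. \<omega> i) \<in> borel_measurable (PiM UNIV ?N)" for i
    using measurable_component_singleton[of i UNIV ?N] by simp
  have distr: "distr (PiM UNIV ?N) borel (\<lambda>\<omega>. \<omega> i) = std_normal_distribution" for i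
    using distr_PiM_component[of UNIV ?N i] N.prob_space_axioms by (simp cong: distr_cong)
  have "distr (PiM UNIV ?N) (\<Pi>\<^sub>M p\<in>UNIV. borel) (\<lambda>\<omega>. \<lambda>p\<in>UNIV. \<omega> (e p)) =
      distr (PiM UNIV ?N) (\<Pi>\<^sub>M p\<in>UNIV. ?N (e p)) (\<lambda>\<omega>. \<lambda>p\<in>UNIV. \<omega> (e p))"
    by (intro distr_cong sets_PiM_cong) auto
  \<comment> \<open>Because \<open>e\<close> is injective, distinct pairs read distinct coordinates,
    so the selected coordinates again have the product law.\<close>
  also have "\<dots> = (\<Pi>\<^sub>M p\<in>UNIV. ?N (e p))"
    using assms by (intro distr_PiM_reindex) (auto intro: N.prob_space_axioms)
  finally have "P.indep_vars (\<lambda>_. borel) (\<lambda>p \<omega>. \<omega> (e p)) UNIV"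
    by (subst P.indep_vars_iff_distr_eq_PiM') (simp_all add: distr)
  then show ?thesis
    by unfold_locales (simp_all add: distr)
qed

theorem mainTheorem1:
  shows "\<exists>(M :: (real \<Rightarrow> real) measure) (B :: real \<Rightarrow> (real \<Rightarrow> real) \<Rightarrow> real).
    prob_space M \<and>
    (\<forall>t\<in>{0..}. B t \<in> borel_measurable M) \<and>
    (\<forall>\<omega>\<in>space M. continuous_on {0..} (\<lambda>t. B t \<omega>)) \<and>
    (AE \<omega> in M. B 0 \<omega> = 0) \<and>
    (\<forall>(n :: nat) (t :: nat \<Rightarrow> real). (\<forall>i\<in>{1..n}. t i \<in> {0..}) \<longrightarrow>
      multivariate_normal M {1..n} (\<lambda>i. B (t i)) (\<lambda>i. 0) (\<lambda>i j. min (t i) (t j)))"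
proof -
  \<comment> \<open>The sample space consists of functions on the reals, so pairs are embedded into
    the index set through their codes as natural numbers.\<close>
  have "inj (\<lambda>p. real (prod_encode p))"
    by (auto intro!: injI dest: injD[OF inj_prod_encode])
  then interpret gaussian_noise "PiM UNIV (\<lambda>_ :: real. std_normal_distribution)"
      "\<lambda>p \<omega>. \<omega> (real (prod_encode p))"
    by (rule gaussian_noise_PiM)
  show ?thesis
    by (intro exI[of _ "PiM UNIV (\<lambda>_ :: real. std_normal_distribution)"] exI[of _ brownian])
      (auto simp: prob_space_axioms AE_brownian_0 intro!: continuous_on_brownian multivariate_normal_brownian)
qed

end
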